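(* Let $q$ be an odd prime power, and for $i\in\{I,II,III\}$ let $N_i(q)$ be the number of stable quadratic 2-sets of type $i$ over the finite field $\mathbf F_q$ with $q$ elements. Then: $N_I(q)=(q-1)/4$ if $q\equiv1\pmod 4$, and $N_I(q)=(q-3)/4$ if $q\equiv 3\pmod 4$; $N_{II}(q)=0$; $N_{III}(q)=q-1$.
   Context: For monic irreducible polynomials $f,g$ over $K=\mathbf F_q$, $f\wedge g$ denotes the minimal polynomial over $K$ of $f(\alpha)$, where $\alpha$ is a root of $g$ (independent of the choice of root). A quadratic 2-set is an unordered set $\{f,g\}$ of two distinct monic irreducible quadratic polynomials over $K$. It is stable if $f\wedge g$ and $g\wedge f$ both belong to $\{f,g\}$. A stable 2-set is of type I if $f\wedge g=g$ and $g\wedge f=f$; of type II if $f\wedge g=f$ and $g\wedge f=g$; of type III if, for one of the two labellings of its elements as $f,g$, one has $f\wedge g=g$ and $g\wedge f=g$. *)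

theory Defs
  imports
    "HOL-Algebra.Algebraic_Closure_Type"
    "HOL-Number_Theory.Prime_Powers"
    "HOL-Number_Theory.Cong"
    "HOL-Library.Cardinality"
begin

text \<open>
  The names \<open>irreducible\<close>, \<open>degree\<close> and \<open>lead_coeff\<close> are qualified below
  because HOL-Algebra, which provides the algebraic closure, has constants of the same base names.
\<close>

definition poly_ac :: "'a :: field poly \<Rightarrow> 'a alg_closure \<Rightarrow> 'a alg_closure" where
  "poly_ac p x = poly (map_poly to_ac p) x"

definition min_poly_ac :: "'a :: field alg_closure \<Rightarrow> 'a poly" where
  "min_poly_ac x = (THE p. Polynomial.lead_coeff p = 1 \<and> poly_ac p x = 0 \<and>
     (\<forall>r. r \<noteq> 0 \<and> poly_ac r x = 0 \<longrightarrow> Polynomial.degree p \<le> Polynomial.degree r))"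

text \<open>
  The polynomial \<open>f \<and> g\<close>. For irreducible \<open>g\<close> the choice of the root does not matter,
  see \<open>wedge_eq\<close> below.
\<close>

definition wedge :: "'a :: field poly \<Rightarrow> 'a poly \<Rightarrow> 'a poly" where
  "wedge f g = min_poly_ac (poly_ac f (SOME \<alpha>. poly_ac g \<alpha> = 0))"

lemma poly_ac_0 [simp]: "poly_ac 0 x = 0"
  by (simp add: poly_ac_def)

lemma poly_ac_pCons [simp]: "poly_ac (pCons a p) x = to_ac a + x * poly_ac p x"
  by (simp add: poly_ac_def map_poly_pCons)

lemma poly_ac_add [simp]: "poly_ac (p + q) x = poly_ac p x + poly_ac q x"
  by (induction p q rule: poly_induct2) (simp_all add: algebra_simps)

lemma poly_ac_smult [simp]: "poly_ac (Polynomial.smult c p) x = to_ac c * poly_ac p x"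
  by (induction p) (simp_all add: algebra_simps)

lemma poly_ac_mult [simp]: "poly_ac (p * q) x = poly_ac p x * poly_ac q x"
  by (induction p) (simp_all add: algebra_simps)

lemma poly_ac_pcompose [simp]: "poly_ac (pcompose p q) x = poly_ac p (poly_ac q x)"
  by (induction p) (simp_all add: pcompose_pCons)

lemma irreducible_dvd_of_root:
  fixes g h :: "'a :: field poly"
  assumes irr: "Factorial_Ring.irreducible g" and g: "poly_ac g x = 0" and h: "poly_ac h x = 0"
  shows "g dvd h"
proof -
  let ?P = "\<lambda>p. p \<noteq> 0 \<and> poly_ac p x = 0"
  have "?P g" using irr g by auto
  then obtain m where m: "?P m" and min: "\<And>p. ?P p \<Longrightarrow> Polynomial.degree m \<le> Polynomial.degree p"
    using ex_has_least_nat[of ?P g Polynomial.degree] by blast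
  have dvd: "m dvd p" if "poly_ac p x = 0" for p
  proof -
    have "poly_ac (p mod m) x = poly_ac (p div m * m + p mod m) x"
      using m by (simp only: poly_ac_add poly_ac_mult) simp
    then have "poly_ac (p mod m) x = 0"
      using that by simp
    then have "p mod m = 0"
      using min[of "p mod m"] degree_mod_less'[of m p] m by (meson not_le)
    then show ?thesis by (simp add: dvd_eq_mod_eq_0)
  qed
  obtain k where k: "g = m * k" using dvd[OF g] by blast
  have "\<not> is_unit m"
  proof
    assume "is_unit m"
    then obtain c where "m = [:c:]" by (auto elim!: is_unit_polyE)
    then show False using m by simp
  qed
  then have "is_unit k" using irr k by (auto dest: irreducibleD)
  then have "g dvd m" using k by (simp add: mult_unit_dvd_iff)
  then show ?thesis using dvd[OF h] by (rule dvd_trans)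
qed

lemma poly_ac_root_exists:
  assumes "Factorial_Ring.irreducible g"
  obtains x where "poly_ac g x = 0"
proof -
  have "Polynomial.degree g > 0"
    using assms by (metis is_unit_iff_degree Factorial_Ring.irreducible_def neq0_conv)
  then have "Polynomial.degree (map_poly to_ac g) > 0"
    by (subst degree_map_poly) auto
  then show ?thesis
    using that alg_closed_imp_poly_has_root unfolding poly_ac_def by blast
qed

lemma wedge_eq:
  assumes irr: "Factorial_Ring.irreducible g" and root: "poly_ac g \<alpha> = 0"
  shows "wedge f g = min_poly_ac (poly_ac f \<alpha>)"
proof -
  define \<beta> where "\<beta> = (SOME \<alpha>. poly_ac g \<alpha> = 0)"
  have \<beta>: "poly_ac g \<beta> = 0" unfolding \<beta>_def using root by (rule someI)
  have "poly_ac r (poly_ac f \<beta>) = 0 \<longleftrightarrow> poly_ac r (poly_ac f \<alpha>) = 0" for r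
    using irreducible_dvd_of_root[OF irr root, of "pcompose r f"]
      irreducible_dvd_of_root[OF irr \<beta>, of "pcompose r f"] root \<beta>
    by (metis dvd_def mult_zero_left poly_ac_mult poly_ac_pcompose)
  then show ?thesis
    by (simp add: wedge_def min_poly_ac_def flip: \<beta>_def)
qed

definition monic_irred_quadratic :: "'a :: field poly \<Rightarrow> bool" where
  "monic_irred_quadratic f \<longleftrightarrow>
     Polynomial.lead_coeff f = 1 \<and> Factorial_Ring.irreducible f \<and> Polynomial.degree f = 2"

definition quadratic_2set :: "'a :: field poly set \<Rightarrow> bool" where
  "quadratic_2set S \<longleftrightarrow>
     (\<exists>f g. S = {f, g} \<and> f \<noteq> g \<and> monic_irred_quadratic f \<and> monic_irred_quadratic g)"

definition stable_2set :: "'a :: field poly set \<Rightarrow> bool" where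
  "stable_2set S \<longleftrightarrow> quadratic_2set S \<and>
     (\<exists>f g. S = {f, g} \<and> f \<noteq> g \<and> wedge f g \<in> S \<and> wedge g f \<in> S)"

text \<open>
  The conditions on \<open>f, g\<close> in the definitions of stability and of types I and II are symmetric
  in \<open>f\<close> and \<open>g\<close>, so there the existential quantifier over the labelling is harmless; in type III
  it is the intended reading.
\<close>

definition type_I :: "'a :: field poly set \<Rightarrow> bool" where
  "type_I S \<longleftrightarrow> stable_2set S \<and>
     (\<exists>f g. S = {f, g} \<and> f \<noteq> g \<and> wedge f g = g \<and> wedge g f = f)"

definition type_II :: "'a :: field poly set \<Rightarrow> bool" where
  "type_II S \<longleftrightarrow> stable_2set S \<and>
     (\<exists>f g. S = {f, g} \<and> f \<noteq> g \<and> wedge f g = f \<and> wedge g f = g)"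

definition type_III :: "'a :: field poly set \<Rightarrow> bool" where
  "type_III S \<longleftrightarrow> stable_2set S \<and>
     (\<exists>f g. S = {f, g} \<and> f \<noteq> g \<and> wedge f g = g \<and> wedge g f = g)"


end

theory Submission
  imports Defs "HOL-Number_Theory.Residues"
begin

text \<open>
  Let \<open>f = x\<^sup>2 + a x + b\<close>, \<open>g = x\<^sup>2 + c x + d\<close>, \<open>u = a - c\<close> and \<open>v = b - d\<close>. A root \<open>\<alpha>\<close> of \<open>g\<close> has
  \<open>f(\<alpha>) = u \<alpha> + v\<close>, so that \<open>f \<and> g\<close>, if quadratic, has linear coefficient \<open>u c - 2 v\<close> and \<open>u\<^sup>2\<close> times
  the discriminant of \<open>g\<close>. Comparing discriminants gives \<open>u\<^sup>2 = 1\<close> in types I and III and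
  \<open>u\<^sup>4 = 1\<close> in type II. What remains is linear: the 2-sets of type I are the \<open>{x\<^sup>2 + b, x\<^sup>2 - x + b}\<close>,
  those of type III are the \<open>{x\<^sup>2 + x/2 + d, x\<^sup>2 - x/2 + d}\<close> and the
  \<open>{x\<^sup>2 - 3x/2 + d + 1/2, x\<^sup>2 - x/2 + d}\<close>; in type II the equations are inconsistent for
  \<open>u\<^sup>2 = 1\<close>, and \<open>u\<^sup>2 = -1\<close> forces \<open>b = 0\<close>, so that \<open>f\<close> is reducible.
  As irreducibility means that the discriminant is a nonsquare, type I amounts to counting the
  \<open>t = - 4 b\<close> for which \<open>t\<close> and \<open>t + 1\<close> are nonsquares, and type III to counting all
  nonsquares twice.
\<close>

section \<open>Squares and nonsquares in finite fields of odd order\<close>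

definition nonsquare :: "'a :: field \<Rightarrow> bool" where
  "nonsquare x \<longleftrightarrow> (\<forall>y. x \<noteq> y\<^sup>2)"

lemma not_nonsquare_power2 [simp]: "\<not> nonsquare (x\<^sup>2)"
  by (auto simp: nonsquare_def)

lemma not_nonsquare_0_1 [simp]: "\<not> nonsquare 0" "\<not> nonsquare 1"
  using not_nonsquare_power2[of 0] not_nonsquare_power2[of 1] by auto

lemma nonsquare_mult_power2: "x \<noteq> 0 \<Longrightarrow> nonsquare (n * x\<^sup>2) \<longleftrightarrow> nonsquare n"
  unfolding nonsquare_def
  by (metis nonzero_mult_div_cancel_right power_divide power_mult_distrib power_not_zero)

text \<open>If 2 vanished, the characteristic would be 2, and the characteristic divides the order
  of the field.\<close>

lemma two_neq_zero_if_odd_CARD: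
  assumes "odd CARD('a :: {field, finite})"
  shows "(2 :: 'a) \<noteq> 0"
proof
  assume "(2 :: 'a) = 0"
  then have "of_nat 2 = (0 :: 'a)" by simp
  then have "CHAR('a) dvd 2" by (simp only: of_nat_eq_0_iff_char_dvd)
  then have "CHAR('a) = 2"
    using CHAR_not_1'[where 'a='a] by (metis One_nat_def primes_dvd_imp_eq prime_nat_iff two_is_prime_nat)
  then show False using CHAR_dvd_CARD[where 'a='a] assms by simp
qed

lemma neq_minus_self:
  fixes y :: "'a :: field"
  assumes "(2 :: 'a) \<noteq> 0" "y \<noteq> 0"
  shows "y \<noteq> - y"
  using assms by (metis add.right_inverse mult_2 mult_eq_0_iff)

lemma four_neq_zero: "(2 :: 'a :: field) \<noteq> 0 \<Longrightarrow> (4 :: 'a) \<noteq> 0"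
  using mult_eq_0_iff[of 2 "2 :: 'a"] by simp

text \<open>Counting along constant fibres. It serves for squaring, which is two-to-one on nonzero
  elements, and for a four-to-one map onto the pairs of consecutive nonsquares.\<close>

lemma card_eq_mult_if_card_fibres:
  assumes "finite S" "finite T" "f ` S \<subseteq> T" "\<And>t. t \<in> T \<Longrightarrow> card {s \<in> S. f s = t} = k"
  shows "card S = k * card T"
proof -
  have "card S = (\<Sum>t\<in>T. card {s \<in> S. f s = t})"
    using sum_fun_comp[OF assms(1-3), of "\<lambda>_. 1 :: nat"] by simp
  then show ?thesis using assms(4) by simp
qed

lemma card_nonzero_squares:
  assumes two: "(2 :: 'a :: {field, finite}) \<noteq> 0"
  shows "2 * card {x :: 'a. x \<noteq> 0 \<and> \<not> nonsquare x} = CARD('a) - 1"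
proof -
  let ?S = "{x :: 'a. x \<noteq> 0 \<and> \<not> nonsquare x}"
  have "card (UNIV - {0 :: 'a}) = 2 * card ?S"
  proof (rule card_eq_mult_if_card_fibres[where f = "\<lambda>x. x\<^sup>2"])
    fix t :: 'a assume "t \<in> ?S"
    then obtain y where y: "t = y\<^sup>2" "y \<noteq> 0" by (auto simp: nonsquare_def)
    have "{s \<in> UNIV - {0}. s\<^sup>2 = t} = {y, - y}"
      using y by (auto simp: power2_eq_iff)
    with neq_minus_self[OF two y(2)] show "card {s \<in> UNIV - {0}. s\<^sup>2 = t} = 2" by simp
  qed auto
  then show ?thesis by (simp add: card_Diff_singleton)
qed

lemma card_nonsquare:
  assumes two: "(2 :: 'a :: {field, finite}) \<noteq> 0"
  shows "2 * card {x :: 'a. nonsquare x} = CARD('a) - 1"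
proof -
  let ?S = "{x :: 'a. x \<noteq> 0 \<and> \<not> nonsquare x}"
  have "card (UNIV - {0 :: 'a}) = card (?S \<union> {x. nonsquare x})"
    by (rule arg_cong[where f = card]) auto
  also have "\<dots> = card ?S + card {x :: 'a. nonsquare x}"
    by (rule card_Un_disjoint) auto
  finally show ?thesis using card_nonzero_squares[OF two] by (simp add: card_Diff_singleton)
qed

text \<open>Multiplication by \<open>n\<close> maps the nonzero squares injectively into the
  nonsquares. Both sets have half the size of the multiplicative group, so the map is onto.\<close>

lemma nonsquare_eq_mult_power2:
  fixes n s :: "'a :: {field, finite}"
  assumes two: "(2 :: 'a) \<noteq> 0" and n: "nonsquare n" and s: "nonsquare s"
  shows "\<exists>y. s = n * y\<^sup>2"
proof -
  let ?S = "{x :: 'a. x \<noteq> 0 \<and> \<not> nonsquare x}"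
  have "n \<noteq> 0" using n by auto
  then have "card ((*) n ` ?S) = card ?S"
    by (intro card_image) (auto simp: inj_on_def)
  also have "\<dots> = card {x :: 'a. nonsquare x}"
    using card_nonzero_squares[OF two] card_nonsquare[OF two] by linarith
  finally have "(*) n ` ?S = {x. nonsquare x}"
  proof (intro card_subset_eq)
    show "(*) n ` ?S \<subseteq> {x. nonsquare x}"
    proof safe
      fix x :: 'a assume "x \<noteq> 0" "\<not> nonsquare x"
      then obtain y where "x = y\<^sup>2" "y \<noteq> 0" by (auto simp: nonsquare_def)
      then show "nonsquare (n * x)" using n by (simp add: nonsquare_mult_power2)
    qed
  qed auto
  with s show ?thesis by (auto simp: nonsquare_def)
qed

text \<open>
  For a fixed nonsquare \<open>n\<close>, the pairs \<open>t, t + 1\<close> of nonsquares are \<open>t = n y\<^sup>2\<close>, \<open>t + 1 = n x\<^sup>2\<close> with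
  \<open>n (x + y) (x - y) = 1\<close>. In terms of \<open>w = x + y\<close> this is \<open>t = (n w\<^sup>2 - 1)\<^sup>2 / (4 n w\<^sup>2)\<close>, and
  each \<open>t\<close> comes from the four values \<open>\<plusminus>w\<close>, \<open>\<plusminus>1 / (n w)\<close>. The two cases are those of \<open>- 1\<close> being a
  square or not; the residue of \<open>CARD('a)\<close> modulo \<open>4\<close> decides between them.
\<close>
lemma card_consecutive_nonsquares:
  assumes two: "(2 :: 'a :: {field, finite}) \<noteq> 0"
  defines "D \<equiv> card {t :: 'a. nonsquare t \<and> nonsquare (t + 1)}"
  shows "CARD('a) = 4 * D + 1 \<or> CARD('a) = 4 * D + 3"
proof -
  have "CARD('a) \<noteq> 1" using card_1_singleton_iff by (metis UNIV_I singletonD zero_neq_one One_nat_def)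
  moreover have "CARD('a) > 0" by (simp add: card_gt_0_iff)
  ultimately have "card {x :: 'a. nonsquare x} > 0" using card_nonsquare[OF two] by linarith
  then obtain n :: 'a where n: "nonsquare n" by (auto simp: card_gt_0_iff)
  then have n0: "n \<noteq> 0" by auto
  have four: "(4 :: 'a) \<noteq> 0" using two by (rule four_neq_zero)
  \<comment> \<open>At the points of \<open>?E\<close> the value \<open>f w + 1\<close> would be 0.
    No point has to be removed for the sake of \<open>f w = 0\<close>, since
    \<open>n * w\<^sup>2 = 1\<close> would make \<open>n\<close> a square.\<close>
  let ?E = "{w :: 'a. n * w\<^sup>2 = -1}"
  let ?W = "UNIV - ({0} \<union> ?E)"
  let ?T = "{t :: 'a. nonsquare t \<and> nonsquare (t + 1)}"
  define f where "f w = (n * w\<^sup>2 - 1)\<^sup>2 / (4 * n * w\<^sup>2)" for w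
  have n1: "n * w\<^sup>2 \<noteq> 1" for w using n nonsquare_mult_power2[of w n]
    by (metis not_nonsquare_0_1(2) power_zero_numeral mult_zero_right zero_neq_one)
  have f1: "f w = n * ((n * w\<^sup>2 - 1) / (2 * n * w))\<^sup>2" if "w \<noteq> 0" for w
    using that n0 two four by (simp add: f_def field_simps power2_eq_square)
  have f2: "f w + 1 = n * ((n * w\<^sup>2 + 1) / (2 * n * w))\<^sup>2" if "w \<noteq> 0" for w
    using that n0 two four by (simp add: f_def field_simps power2_eq_square)
  have "card ?W = 4 * card ?T"
  proof (rule card_eq_mult_if_card_fibres[where f = f])
    show "f ` ?W \<subseteq> ?T"
    proof (intro image_subsetI)
      fix w assume "w \<in> ?W"
      then have w: "n * w\<^sup>2 + 1 \<noteq> 0" "w \<noteq> 0" by (auto simp: eq_neg_iff_add_eq_0)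
      have "nonsquare (f w + 1)"
        unfolding f2[OF w(2)] using w n n0 two by (simp add: nonsquare_mult_power2)
      moreover have "nonsquare (f w)"
        unfolding f1[OF w(2)] using w n1[of w] n n0 two by (simp add: nonsquare_mult_power2)
      ultimately show "f w \<in> ?T" by simp
    qed
  next
    fix t assume t: "t \<in> ?T"
    obtain x y where xy: "t = n * y\<^sup>2" "t + 1 = n * x\<^sup>2" using nonsquare_eq_mult_power2[OF two n] t by blast
    then have e: "n * (x + y) * (x - y) = 1" by (simp add: algebra_simps power2_eq_square)
    define w where "w = x + y"
    have w0: "w \<noteq> 0" using e by (auto simp: w_def)
    have x0: "x \<noteq> 0" "y \<noteq> 0" using t xy by auto
    have xmy: "x - y = 1 / (n * w)" using e w0 n0 by (simp add: w_def eq_divide_eq ac_simps)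
    have y_w: "y = (n * w\<^sup>2 - 1) / (2 * n * w)" and x_w: "x = (n * w\<^sup>2 + 1) / (2 * n * w)"
    proof -
      have "2 * x = w + 1 / (n * w)" "2 * y = w - 1 / (n * w)"
        using xmy by (simp_all add: w_def algebra_simps)
      then show "y = (n * w\<^sup>2 - 1) / (2 * n * w)" "x = (n * w\<^sup>2 + 1) / (2 * n * w)"
        using two n0 w0 by (simp_all add: field_simps power2_eq_square)
    qed
    have wW: "n * w\<^sup>2 \<noteq> -1" using x_w x0 by auto
    have "f v = t \<longleftrightarrow> v \<in> {w, - w, 1 / (n * w), - (1 / (n * w))}" if v: "v \<noteq> 0" for v
    proof -
      have "f v = t \<longleftrightarrow> f v = f w" using f1[OF w0] xy y_w by simp
      \<comment> \<open>After clearing denominators the equation is quadratic in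
        \<open>v\<^sup>2\<close>; splitting off the known root \<open>w\<^sup>2\<close> leaves the
        second factor.\<close>
      also have "\<dots> \<longleftrightarrow> (v\<^sup>2 - w\<^sup>2) * (n\<^sup>2 * w\<^sup>2 * v\<^sup>2 - 1) = 0"
      proof -
        have "(n * v\<^sup>2 - 1)\<^sup>2 * (4 * n * w\<^sup>2) - (n * w\<^sup>2 - 1)\<^sup>2 * (4 * n * v\<^sup>2)
            = 4 * n * ((v\<^sup>2 - w\<^sup>2) * (n\<^sup>2 * w\<^sup>2 * v\<^sup>2 - 1))"
          by (simp add: algebra_simps power2_eq_square)
        moreover have "f v = f w \<longleftrightarrow> (n * v\<^sup>2 - 1)\<^sup>2 * (4 * n * w\<^sup>2) = (n * w\<^sup>2 - 1)\<^sup>2 * (4 * n * v\<^sup>2)"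
          unfolding f_def using v w0 n0 four by (intro frac_eq_eq) auto
        ultimately show ?thesis using n0 four by (metis eq_iff_diff_eq_0 mult_eq_0_iff)
      qed
      also have "\<dots> \<longleftrightarrow> v\<^sup>2 = w\<^sup>2 \<or> v\<^sup>2 = (1 / (n * w))\<^sup>2"
        unfolding mult_eq_0_iff right_minus_eq power_divide power_mult_distrib
        using w0 n0 by (simp add: eq_divide_eq ac_simps)
      finally show ?thesis by (simp only: power2_eq_iff insert_iff empty_iff disj_assoc simp_thms)
    qed
    moreover have "{w, - w, 1 / (n * w), - (1 / (n * w))} \<subseteq> ?W"
    proof -
      \<comment> \<open>The expression \<open>n * w\<^sup>2\<close> at \<open>w\<close> and at
        \<open>1 / (n * w)\<close> takes mutually inverse values, so one is -1 only if the other
        is.\<close>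
      have "n * (1 / (n * w))\<^sup>2 * (n * w\<^sup>2) = 1" using w0 n0 by (simp add: power2_eq_square)
      then have "n * (1 / (n * w))\<^sup>2 \<noteq> - 1" using wW by (metis mult_minus1 minus_equation_iff)
      then show ?thesis using w0 n0 wW by simp
    qed
    ultimately have "{w \<in> ?W. f w = t} = {w, - w, 1 / (n * w), - (1 / (n * w))}" by blast
    moreover have "w \<noteq> 1 / (n * w)" "w \<noteq> - (1 / (n * w))"
      using w0 n0 n1[of w] wW by (auto simp: field_simps power2_eq_square)
    moreover have "- w \<noteq> 1 / (n * w)" "- w \<noteq> - (1 / (n * w))"
      using calculation(2,3) by (metis minus_minus)+
    ultimately show "card {w \<in> ?W. f w = t} = 4"
      using neq_minus_self[OF two w0] neq_minus_self[OF two, of "1 / (n * w)"] w0 n0 by simp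
  qed auto
  moreover have "CARD('a) = card ?W + (1 + card ?E)"
  proof -
    have "CARD('a) = card (?W \<union> ({0} \<union> ?E))" by (rule arg_cong[where f = card]) auto
    also have "\<dots> = card ?W + card ({0} \<union> ?E)" by (rule card_Un_disjoint) auto
    also have "card ({0} \<union> ?E) = 1 + card ?E" by simp
    finally show ?thesis .
  qed
  \<comment> \<open>A point of \<open>?E\<close> exhibits -1 as a nonsquare. The sizes 0 and 2 yield
    the remainders 1 and 3.\<close>
  moreover have "card ?E = 0 \<or> card ?E = 2"
  proof (cases "?E = {}")
    case False
    then obtain w where w: "n * w\<^sup>2 = -1" by blast
    then have "w \<noteq> 0" by auto
    have "?E = {w, - w}" using w n0 by (auto simp flip: w simp: power2_eq_iff)
    then show ?thesis using neq_minus_self[OF two \<open>w \<noteq> 0\<close>] by simp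
  qed auto
  ultimately show ?thesis unfolding D_def by auto
qed

section \<open>Minimal polynomials and the wedge of two quadratics\<close>

text \<open>Linear independence of 1 and \<alpha> over the base field: otherwise the quadratic
  \<open>g\<close> would divide a nonzero polynomial of degree at most 1. This permits comparing
  coefficients.\<close>

lemma linear_at_root_eq_0:
  fixes g :: "'a :: field poly"
  assumes "monic_irred_quadratic g" "poly_ac g \<alpha> = 0" "to_ac u * \<alpha> + to_ac v = 0"
  shows "u = 0 \<and> v = 0"
proof (rule ccontr)
  assume *: "\<not> (u = 0 \<and> v = 0)"
  have "poly_ac [:v, u:] \<alpha> = 0" using assms(3) by (simp add: algebra_simps)
  with assms have "g dvd [:v, u:]"
    by (auto intro: irreducible_dvd_of_root simp: monic_irred_quadratic_def)
  then have "Polynomial.degree g \<le> Polynomial.degree [:v, u:]"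
    using * by (intro dvd_imp_degree_le) auto
  then show False using assms(1) by (auto simp: monic_irred_quadratic_def split: if_splits)
qed

text \<open>An irreducible annihilator divides every other one, and a monic multiple of
  \<open>h\<close> of no larger degree is \<open>h\<close> itself.\<close>

lemma min_poly_ac_unique:
  fixes h :: "'a :: field poly"
  assumes h: "Polynomial.lead_coeff h = 1" "Factorial_Ring.irreducible h" "poly_ac h x = 0"
  shows "min_poly_ac x = h"
  unfolding min_poly_ac_def
proof (rule the_equality)
  show "Polynomial.lead_coeff h = 1 \<and> poly_ac h x = 0 \<and>
     (\<forall>r. r \<noteq> 0 \<and> poly_ac r x = 0 \<longrightarrow> Polynomial.degree h \<le> Polynomial.degree r)"
    using h by (auto intro: dvd_imp_degree_le irreducible_dvd_of_root)
next
  fix p assume p: "Polynomial.lead_coeff p = 1 \<and> poly_ac p x = 0 \<and>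
     (\<forall>r. r \<noteq> 0 \<and> poly_ac r x = 0 \<longrightarrow> Polynomial.degree p \<le> Polynomial.degree r)"
  have "h \<noteq> 0" using h by auto
  then have le: "Polynomial.degree p \<le> Polynomial.degree h" using p h by blast
  have "h dvd p" using p h by (auto intro: irreducible_dvd_of_root)
  then obtain k where k: "p = h * k" by blast
  have "k \<noteq> 0" using k p by auto
  with le k \<open>h \<noteq> 0\<close> have "Polynomial.degree k = 0" by (simp add: degree_mult_eq)
  then obtain c where c: "k = [:c:]" by (meson degree_eq_zeroE)
  have "Polynomial.lead_coeff p = Polynomial.lead_coeff h * Polynomial.lead_coeff k"
    unfolding k by (rule lead_coeff_mult)
  then have "c = 1" using c p h by simp
  then show "p = h" using c k by simp
qed

text \<open>The definite description in \<open>min_poly_ac\<close> says nothing before existence is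
  known. An annihilator of least degree, made monic, is irreducible: in any factorisation one factor
  vanishes at \<open>x\<close> and thus already has full degree.\<close>

lemma poly_ac_min_poly_ac:
  fixes r :: "'a :: field poly"
  assumes "r \<noteq> 0" "poly_ac r x = 0"
  shows "poly_ac (min_poly_ac x) x = 0"
proof -
  let ?P = "\<lambda>p :: 'a poly. p \<noteq> 0 \<and> poly_ac p x = 0"
  obtain m where m: "?P m" and min: "\<And>p. ?P p \<Longrightarrow> Polynomial.degree m \<le> Polynomial.degree p"
    using ex_has_least_nat[of ?P r Polynomial.degree] assms by blast
  define h where "h = Polynomial.smult (inverse (Polynomial.lead_coeff m)) m"
  have h: "?P h" "Polynomial.lead_coeff h = 1" "Polynomial.degree h = Polynomial.degree m"
    using m by (simp_all add: h_def)
  have unit: "is_unit b" if "h = a * b" "poly_ac a x = 0" for a b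
  proof -
    have nz: "a \<noteq> 0" "b \<noteq> 0" using that h by auto
    then have "Polynomial.degree h \<le> Polynomial.degree a" using min that h by metis
    then have "Polynomial.degree b = 0" using that nz by (simp add: degree_mult_eq)
    then show ?thesis using nz by (simp add: is_unit_iff_degree)
  qed
  have "Factorial_Ring.irreducible h"
  proof (rule Factorial_Ring.irreducibleI)
    show "h \<noteq> 0" using h by simp
    show "\<not> is_unit h" using h by (auto elim!: is_unit_polyE)
    fix a b assume ab: "h = a * b"
    then have "poly_ac a x = 0 \<or> poly_ac b x = 0" using h by auto
    then show "is_unit a \<or> is_unit b" using unit[of a b] unit[of b a] ab by (auto simp: mult.commute)
  qed
  then show ?thesis using min_poly_ac_unique[of h x] h by auto
qed

text \<open>Turns a wedge condition into polynomial equations in the coefficients: \<beta> =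
  f(\<alpha>) is linear in \<alpha>, and \<open>[:t, s, 1:]\<close> is evaluated at \<beta> in the
  basis 1, \<alpha>.\<close>

lemma wedge_eq_iff:
  fixes a b c d s t :: "'a :: field"
  assumes g: "monic_irred_quadratic [:d, c, 1:]" and h: "monic_irred_quadratic [:t, s, 1:]"
  shows "wedge [:b, a, 1:] [:d, c, 1:] = [:t, s, 1:] \<longleftrightarrow>
    s = (a - c) * c - 2 * (b - d) \<and> t = (a - c)\<^sup>2 * d - s * (b - d) - (b - d)\<^sup>2"
proof -
  define u v where "u = a - c" and "v = b - d"
  have irr: "Factorial_Ring.irreducible [:d, c, 1:]" "Factorial_Ring.irreducible [:t, s, 1:]"
    using g h by (auto simp: monic_irred_quadratic_def)
  obtain \<alpha> where root: "poly_ac [:d, c, 1:] \<alpha> = 0" using poly_ac_root_exists[OF irr(1)] .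
  have \<alpha>2: "\<alpha> * \<alpha> = - (to_ac d + to_ac c * \<alpha>)"
    using root by (simp add: algebra_simps eq_neg_iff_add_eq_0)
  define \<beta> where "\<beta> = poly_ac [:b, a, 1:] \<alpha>"
  have \<beta>: "\<beta> = to_ac u * \<alpha> + to_ac v"
    using \<alpha>2 by (simp add: \<beta>_def u_def v_def algebra_simps)
  have eval: "poly_ac [:y, x, 1:] \<beta> =
      to_ac (u * (2 * v - u * c + x)) * \<alpha> + to_ac (v\<^sup>2 - u\<^sup>2 * d + x * v + y)" for x y
  proof -
    have "poly_ac [:y, x, 1:] \<beta> = to_ac u * to_ac u * (\<alpha> * \<alpha>) + 2 * to_ac u * to_ac v * \<alpha>
        + to_ac v * to_ac v + to_ac x * (to_ac u * \<alpha> + to_ac v) + to_ac y"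
      by (simp add: \<beta> algebra_simps)
    also have "\<dots> = to_ac (u * (2 * v - u * c + x)) * \<alpha> + to_ac (v\<^sup>2 - u\<^sup>2 * d + x * v + y)"
      unfolding \<alpha>2 by (simp add: algebra_simps power2_eq_square)
    finally show ?thesis .
  qed
  \<comment> \<open>The characteristic polynomial of \<beta>, chosen so that both coordinates in
    \<open>eval\<close> vanish. It shows that \<beta> is algebraic whether or not it is
    quadratic.\<close>
  have "poly_ac [:u\<^sup>2 * d - (u * c - 2 * v) * v - v\<^sup>2, u * c - 2 * v, 1:] \<beta> = 0"
    unfolding eval by (simp add: algebra_simps)
  then have alg: "poly_ac (min_poly_ac \<beta>) \<beta> = 0"
    by (rule poly_ac_min_poly_ac[rotated]) simp
  have "wedge [:b, a, 1:] [:d, c, 1:] = [:t, s, 1:] \<longleftrightarrow> min_poly_ac \<beta> = [:t, s, 1:]"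
    by (simp add: wedge_eq[OF irr(1) root] \<beta>_def)
  also have "\<dots> \<longleftrightarrow> poly_ac [:t, s, 1:] \<beta> = 0"
  proof
    show "min_poly_ac \<beta> = [:t, s, 1:] \<Longrightarrow> poly_ac [:t, s, 1:] \<beta> = 0" using alg by simp
    show "poly_ac [:t, s, 1:] \<beta> = 0 \<Longrightarrow> min_poly_ac \<beta> = [:t, s, 1:]"
      by (rule min_poly_ac_unique) (use irr in auto)
  qed
  also have "\<dots> \<longleftrightarrow> u * (2 * v - u * c + s) = 0 \<and> v\<^sup>2 - u\<^sup>2 * d + s * v + t = 0"
    unfolding eval using linear_at_root_eq_0[OF g root]
    by (metis add_0 mult_zero_left to_ac_0)
  also have "\<dots> \<longleftrightarrow> 2 * v - u * c + s = 0 \<and> v\<^sup>2 - u\<^sup>2 * d + s * v + t = 0"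
  proof -
    \<comment> \<open>For \<open>u = 0\<close> the first equation would be void, but then the second
      would make \<open>v\<close> a root of the irreducible \<open>[:t, s, 1:]\<close>. Hence
      \<open>u\<close> can be cancelled.\<close>
    have "v\<^sup>2 + s * v + t \<noteq> 0"
    proof
      assume "v\<^sup>2 + s * v + t = 0"
      then have "to_ac (v\<^sup>2 + s * v + t) = to_ac 0" by (simp only:)
      then have "poly_ac [:t, s, 1:] (to_ac v) = 0"
        by (simp add: algebra_simps power2_eq_square)
      from linear_at_root_eq_0[OF h this, of 1 "- v"] show False by simp
    qed
    then show ?thesis by auto
  qed
  also have "\<dots> \<longleftrightarrow> s = u * c - 2 * v \<and> t = u\<^sup>2 * d - s * v - v\<^sup>2"
    by (auto simp: algebra_simps eq_neg_iff_add_eq_0)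
  finally show ?thesis by (simp add: u_def v_def)
qed

section \<open>Irreducible monic quadratics and their discriminants\<close>

lemma irreducible_monic_quadratic_iff:
  fixes a b :: "'a :: field"
  shows "Factorial_Ring.irreducible [:b, a, 1:] \<longleftrightarrow> (\<forall>x. poly [:b, a, 1:] x \<noteq> 0)"
proof (intro iffI allI notI)
  fix x assume irr: "Factorial_Ring.irreducible [:b, a, 1:]" and "poly [:b, a, 1:] x = 0"
  then obtain k where k: "[:b, a, 1:] = [:- x, 1:] * k" unfolding poly_eq_0_iff_dvd by (elim dvdE)
  then have "k \<noteq> 0" by auto
  then have "Polynomial.degree [:b, a, 1:] = 1 + Polynomial.degree k"
    unfolding k by (subst degree_mult_eq) auto
  then have "Polynomial.degree k = 1" by simp
  moreover have "is_unit [:- x, 1:] \<or> is_unit k" using irreducibleD[OF irr k] .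
  ultimately show False by (auto simp: is_unit_iff_degree \<open>k \<noteq> 0\<close>)
next
  assume no_root: "\<forall>x. poly [:b, a, 1:] x \<noteq> 0"
  show "Factorial_Ring.irreducible [:b, a, 1:]"
  proof (rule Factorial_Ring.irreducibleI)
    show "\<not> is_unit [:b, a, 1:]" by (simp add: is_unit_iff_degree)
    fix p r assume pr: "[:b, a, 1:] = p * r"
    then have nz: "p \<noteq> 0" "r \<noteq> 0" by auto
    have "Polynomial.degree [:b, a, 1:] = Polynomial.degree p + Polynomial.degree r"
      unfolding pr using nz by (rule degree_mult_eq)
    then have deg: "Polynomial.degree p + Polynomial.degree r = 2" by simp
    have no_lin: "Polynomial.degree s \<noteq> 1" if "s dvd [:b, a, 1:]" for s
    proof
      assume "Polynomial.degree s = 1"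
      then obtain k l where s: "s = [:k, l:]" "l \<noteq> 0"
        using degree1_coeffs by metis
      then have "poly s (- k / l) = 0" by simp
      then show False using that no_root by (metis dvdE mult_zero_left poly_mult)
    qed
    have "Polynomial.degree p \<noteq> 1" using no_lin[of p] pr by simp
    then have "Polynomial.degree p = 0 \<or> Polynomial.degree r = 0" using deg by linarith
    then show "is_unit p \<or> is_unit r" using nz by (simp add: is_unit_iff_degree)
  qed auto
qed

text \<open>Completing the square: a root \<open>x\<close> corresponds to the square root
  \<open>2 * x + a\<close> of the discriminant.\<close>

lemma monic_irred_quadratic_pCons_iff:
  fixes a b :: "'a :: field"
  assumes two: "(2 :: 'a) \<noteq> 0"
  shows "monic_irred_quadratic [:b, a, 1:] \<longleftrightarrow> nonsquare (a\<^sup>2 - 4 * b)"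
proof -
  have sq: "a\<^sup>2 - 4 * b = (2 * x + a)\<^sup>2 \<longleftrightarrow> poly [:b, a, 1:] x = 0" for x
  proof -
    have "a\<^sup>2 - 4 * b - (2 * x + a)\<^sup>2 = - (2 * 2) * poly [:b, a, 1:] x"
      by (simp add: algebra_simps power2_eq_square)
    then show ?thesis using two by (metis eq_iff_diff_eq_0 mult_eq_0_iff neg_equal_0_iff_equal)
  qed
  have "(\<exists>y. a\<^sup>2 - 4 * b = y\<^sup>2) \<longleftrightarrow> (\<exists>x. poly [:b, a, 1:] x = 0)"
  proof
    assume "\<exists>y. a\<^sup>2 - 4 * b = y\<^sup>2"
    then obtain y where y: "a\<^sup>2 - 4 * b = y\<^sup>2" ..
    have "2 * ((y - a) / 2) + a = y"
      unfolding times_divide_eq_right nonzero_mult_div_cancel_left[OF two] by simp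
    then show "\<exists>x. poly [:b, a, 1:] x = 0" using y sq[of "(y - a) / 2"] by metis
  qed (use sq in blast)
  then show ?thesis
    by (auto simp: monic_irred_quadratic_def irreducible_monic_quadratic_iff nonsquare_def)
qed

lemma monic_irred_quadraticE:
  assumes "monic_irred_quadratic f"
  obtains a b where "f = [:b, a, 1:]"
proof -
  have "Polynomial.degree f = 2" "Polynomial.coeff f 2 = 1"
    using assms by (auto simp: monic_irred_quadratic_def)
  then have "f = [:Polynomial.coeff f 0, Polynomial.coeff f 1, 1:]"
    by (intro poly_eqI) (auto simp: coeff_pCons numeral_2_eq_2 coeff_eq_0 split: nat.split)
  then show ?thesis using that by blast
qed

section \<open>Classification of the stable 2-sets of each type\<close>

text \<open>Merges the separate labellings in the definitions of the types into one. With
  \<open>P\<close> the condition of a type, stability adds only that both members are monic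
  irreducible quadratics.\<close>

lemma stable_2set_labelled_iff:
  assumes "\<And>f g. P f g \<Longrightarrow> wedge f g \<in> {f, g} \<and> wedge g f \<in> {f, g}"
  shows "stable_2set S \<and> (\<exists>f g. S = {f, g} \<and> f \<noteq> g \<and> P f g) \<longleftrightarrow>
    (\<exists>f g. S = {f, g} \<and> f \<noteq> g \<and> monic_irred_quadratic f \<and> monic_irred_quadratic g \<and> P f g)"
proof
  assume *: "stable_2set S \<and> (\<exists>f g. S = {f, g} \<and> f \<noteq> g \<and> P f g)"
  then obtain f g where fg: "S = {f, g}" "f \<noteq> g" "P f g" by blast
  obtain f' g' where "S = {f', g'}" "monic_irred_quadratic f'" "monic_irred_quadratic g'"
    using * unfolding stable_2set_def quadratic_2set_def by blast
  then have "monic_irred_quadratic h" if "h \<in> S" for h using that by blast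
  then have "monic_irred_quadratic f" "monic_irred_quadratic g" using fg by blast+
  with fg show "\<exists>f g. S = {f, g} \<and> f \<noteq> g \<and> monic_irred_quadratic f \<and> monic_irred_quadratic g \<and> P f g"
    by blast
next
  assume "\<exists>f g. S = {f, g} \<and> f \<noteq> g \<and> monic_irred_quadratic f \<and> monic_irred_quadratic g \<and> P f g"
  then obtain f g where fg: "S = {f, g}" "f \<noteq> g" "monic_irred_quadratic f" "monic_irred_quadratic g" "P f g"
    by blast
  then have "wedge f g \<in> S" "wedge g f \<in> S" using assms by blast+
  with fg show "stable_2set S \<and> (\<exists>f g. S = {f, g} \<and> f \<noteq> g \<and> P f g)"
    unfolding stable_2set_def quadratic_2set_def by blast
qed

context
  assumes two: "(2 :: 'a :: field) \<noteq> 0"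
begin

text \<open>The differences are 1, -1 and 2. These inequalities keep the members of a type III 2-set
  distinct and its two families disjoint, also in characteristic 3, where \<open>3 / 2\<close> is
  0.\<close>

lemma halves_neq: "1 / 2 \<noteq> - (1 / 2 :: 'a)" "- (3 / 2) \<noteq> - (1 / 2 :: 'a)" "1 / 2 \<noteq> - (3 / 2 :: 'a)"
proof -
  have "1 / 2 - - (1 / 2) = (1 :: 'a)" "- (3 / 2) - - (1 / 2) = (-1 :: 'a)" "1 / 2 - - (3 / 2) = (2 :: 'a)"
    using two by (simp_all add: field_simps)
  then show "1 / 2 \<noteq> - (1 / 2 :: 'a)" "- (3 / 2) \<noteq> - (1 / 2 :: 'a)" "1 / 2 \<noteq> - (3 / 2 :: 'a)"
    using two by (metis diff_self neg_equal_0_iff_equal zero_neq_one, metis diff_self neg_equal_0_iff_equal zero_neq_one, metis diff_self)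
qed

text \<open>The discriminant is the squared difference of the conjugates, and \<beta> = u \<alpha> +
  v scales that difference by \<open>u = a - c\<close>.\<close>

lemma wedge_disc:
  fixes a b c d s t :: 'a
  assumes "s = (a - c) * c - 2 * (b - d)" "t = (a - c)\<^sup>2 * d - s * (b - d) - (b - d)\<^sup>2"
  shows "s\<^sup>2 - 4 * t = (a - c)\<^sup>2 * (c\<^sup>2 - 4 * d)"
  unfolding assms(2) unfolding assms(1) by (simp add: algebra_simps power2_eq_square)

text \<open>Equality of discriminants gives \<open>a - c\<close> = 1 or -1. In either case one
  linear equation yields \<open>b = d\<close> and the other \<open>2 * a = 0\<close> or
  \<open>2 * c = 0\<close>.\<close>

lemma wedge_swap_iff:
  fixes a b c d :: 'a
  assumes f: "monic_irred_quadratic [:b, a, 1:]" and g: "monic_irred_quadratic [:d, c, 1:]"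
  shows "wedge [:b, a, 1:] [:d, c, 1:] = [:d, c, 1:] \<and> wedge [:d, c, 1:] [:b, a, 1:] = [:b, a, 1:] \<longleftrightarrow>
    b = d \<and> (a = 0 \<and> c = -1 \<or> a = -1 \<and> c = 0)"
  unfolding wedge_eq_iff[OF f f] wedge_eq_iff[OF g g] wedge_eq_iff[OF f g] wedge_eq_iff[OF g f]
proof (intro iffI)
  assume *: "(c = (a - c) * c - 2 * (b - d) \<and> d = (a - c)\<^sup>2 * d - c * (b - d) - (b - d)\<^sup>2) \<and>
    a = (c - a) * a - 2 * (d - b) \<and> b = (c - a)\<^sup>2 * b - a * (d - b) - (d - b)\<^sup>2"
  have "c\<^sup>2 - 4 * d \<noteq> 0" using g two by (auto simp: monic_irred_quadratic_pCons_iff)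
  moreover have "c\<^sup>2 - 4 * d = (a - c)\<^sup>2 * (c\<^sup>2 - 4 * d)" using * wedge_disc by blast
  ultimately have "(a - c)\<^sup>2 = 1" by (metis mult_cancel_right1)
  then have "a = c + 1 \<or> a = c - 1" unfolding power2_eq_1_iff by (auto simp: algebra_simps)
  then show "b = d \<and> (a = 0 \<and> c = -1 \<or> a = -1 \<and> c = 0)"
  proof
    assume a: "a = c + 1"
    have "2 * (b - d) = (a - c) * c - c" using * by (simp add: algebra_simps)
    then have bd: "b = d" using two a by simp
    have ca: "c - a = -1" using a by simp
    have "2 * a = a - ((c - a) * a - 2 * (d - b))" unfolding ca bd by simp
    also have "\<dots> = 0" unfolding right_minus_eq using * by blast
    finally have "2 * a = 0" .
    then have "a = 0" using two by simp
    moreover from this have "c = -1" using a by (simp add: eq_neg_iff_add_eq_0)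
    ultimately show ?thesis using bd by simp
  next
    assume a: "a = c - 1"
    have "2 * (b - d) = (a - (c - a) * a)" using * by (simp add: algebra_simps)
    then have bd: "b = d" using two a by simp
    have ac: "a - c = -1" using a by simp
    have "2 * c = c - ((a - c) * c - 2 * (b - d))" unfolding ac bd by simp
    also have "\<dots> = 0" unfolding right_minus_eq using * by blast
    finally have "2 * c = 0" .
    then have "c = 0" using two by simp
    then show ?thesis using a bd by simp
  qed
qed auto

lemma not_wedge_fix:
  fixes a b c d :: 'a
  assumes f: "monic_irred_quadratic [:b, a, 1:]" and g: "monic_irred_quadratic [:d, c, 1:]"
  shows "\<not> (wedge [:b, a, 1:] [:d, c, 1:] = [:b, a, 1:] \<and> wedge [:d, c, 1:] [:b, a, 1:] = [:d, c, 1:])"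
  unfolding wedge_eq_iff[OF f f] wedge_eq_iff[OF g g] wedge_eq_iff[OF f g] wedge_eq_iff[OF g f]
proof
  assume *: "(a = (a - c) * c - 2 * (b - d) \<and> b = (a - c)\<^sup>2 * d - a * (b - d) - (b - d)\<^sup>2) \<and>
    c = (c - a) * a - 2 * (d - b) \<and> d = (c - a)\<^sup>2 * b - c * (d - b) - (d - b)\<^sup>2"
  then have E: "a - ((a - c) * c - 2 * (b - d)) = 0" "c - ((c - a) * a - 2 * (d - b)) = 0"
    unfolding right_minus_eq by blast+
  define u v where "u = a - c" and "v = b - d"
  have nz: "c\<^sup>2 - 4 * d \<noteq> 0" "b \<noteq> 0"
    using f g two by (auto simp: monic_irred_quadratic_pCons_iff)
  have D: "a\<^sup>2 - 4 * b = (a - c)\<^sup>2 * (c\<^sup>2 - 4 * d)" "c\<^sup>2 - 4 * d = (c - a)\<^sup>2 * (a\<^sup>2 - 4 * b)"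
    using * wedge_disc by blast+
  have D0: "(a - c)\<^sup>2 * (c\<^sup>2 - 4 * d) - (a\<^sup>2 - 4 * b) = 0"
    unfolding right_minus_eq by (rule D(1)[symmetric])
  \<comment> \<open>Going around both discriminant equations multiplies the discriminant of
    \<open>g\<close> by \<open>u\<close> to the fourth power, which is therefore 1.\<close>
  have "(u\<^sup>2 - 1) * (u\<^sup>2 + 1) * (c\<^sup>2 - 4 * d) = (c - a)\<^sup>2 * ((a - c)\<^sup>2 * (c\<^sup>2 - 4 * d)) - (c\<^sup>2 - 4 * d)"
    by (simp add: u_def algebra_simps power2_eq_square)
  also have "\<dots> = 0" unfolding D(1)[symmetric] right_minus_eq by (rule D(2)[symmetric])
  finally have "(u\<^sup>2 - 1) * (u\<^sup>2 + 1) = 0" using nz by simp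
  moreover have u2: "u\<^sup>2 = - (a + c)"
  proof -
    \<comment> \<open>Adding the two linear equations eliminates \<open>v\<close>.\<close>
    have "u\<^sup>2 + (a + c) = (a - ((a - c) * c - 2 * (b - d))) + (c - ((c - a) * a - 2 * (d - b)))"
      by (simp add: u_def algebra_simps power2_eq_square)
    then show ?thesis unfolding E by (simp only: eq_neg_iff_add_eq_0 add_0)
  qed
  ultimately consider "u = 1" | "u = -1" | "u\<^sup>2 = -1"
    by (auto simp: power2_eq_1_iff eq_neg_iff_add_eq_0)
  then show False
  proof cases
    case 1
    have "2 * a = u - u\<^sup>2" unfolding u2 by (simp add: u_def)
    then have "a = 0" using two 1 by simp
    moreover have "c = a - u" by (simp add: u_def)
    ultimately have ac: "a = 0" "c = -1" using 1 by simp_all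
    \<comment> \<open>The linear equation forces \<open>2 * v = -1\<close> while the discriminants
      force \<open>4 * v = -1\<close>; together they give 1 = 0.\<close>
    have "2 * v + 1 = a - ((a - c) * c - 2 * (b - d))" unfolding ac v_def by simp
    moreover have "4 * v + 1 = (a - c)\<^sup>2 * (c\<^sup>2 - 4 * d) - (a\<^sup>2 - 4 * b)"
      unfolding ac v_def by (simp add: algebra_simps)
    moreover have "2 * (2 * v + 1) - (4 * v + 1) = 1" by (simp add: algebra_simps)
    ultimately show False unfolding E D0 by simp
  next
    case 2
    have "2 * c = - u - u\<^sup>2" unfolding u2 by (simp add: u_def)
    then have "c = 0" using two 2 by simp
    moreover have "a = c + u" by (simp add: u_def)
    ultimately have ac: "c = 0" "a = -1" using 2 by simp_all
    have "2 * v - 1 = a - ((a - c) * c - 2 * (b - d))" unfolding ac v_def by simp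
    moreover have "4 * v - 1 = (a - c)\<^sup>2 * (c\<^sup>2 - 4 * d) - (a\<^sup>2 - 4 * b)"
      unfolding ac v_def by (simp add: algebra_simps)
    moreover have "(4 * v - 1) - 2 * (2 * v - 1) = 1" by (simp add: algebra_simps)
    ultimately show False unfolding E D0 by simp
  next
    case 3
    have "- (a + c) = - 1" using 3 u2 by (simp only:)
    then have "a + c = 1" by (simp only: neg_equal_iff_equal)
    then have c: "c = 1 - a" by (simp add: algebra_simps)
    have a2: "2 * a = 1 + u" and c2: "2 * c = 1 - u" unfolding u_def c by simp_all
    have "4 * v = 2 * (a - ((a - c) * c - 2 * (b - d))) + u * (2 * c) - 2 * a"
      unfolding u_def v_def by (simp add: algebra_simps)
    also have "\<dots> = - u\<^sup>2 - 1" unfolding E a2 c2 by (simp add: algebra_simps power2_eq_square)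
    finally have "v = 0" using 3 four_neq_zero[OF two] by simp
    then have bd: "d = b" by (simp add: v_def)
    \<comment> \<open>The discriminants are now opposite, so their sum vanishes. So does
      \<open>(2 * a)\<^sup>2 + (2 * c)\<^sup>2\<close>, which leaves \<open>32 b = 0\<close>,
      contrary to \<open>b \<noteq> 0\<close>.\<close>
    have "4 * (4 * (2 * b)) = (2 * a)\<^sup>2 + (2 * c)\<^sup>2 - 4 * ((a\<^sup>2 - 4 * b) + (c\<^sup>2 - 4 * d))"
      unfolding bd by (simp add: algebra_simps power2_eq_square)
    also have "(2 * a)\<^sup>2 + (2 * c)\<^sup>2 = 2 * (1 + u\<^sup>2)"
      unfolding a2 c2 by (simp add: algebra_simps power2_eq_square)
    also have "a\<^sup>2 - 4 * b = - (c\<^sup>2 - 4 * d)" using D(1) 3 by (simp add: u_def)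
    finally have "4 * (4 * (2 * b)) = 0" using 3 by simp
    then show False using nz two four_neq_zero[OF two] by (metis mult_eq_0_iff)
  qed
qed

lemma wedge_collapse_iff:
  fixes a b c d :: 'a
  assumes f: "monic_irred_quadratic [:b, a, 1:]" and g: "monic_irred_quadratic [:d, c, 1:]"
  shows "wedge [:b, a, 1:] [:d, c, 1:] = [:d, c, 1:] \<and> wedge [:d, c, 1:] [:b, a, 1:] = [:d, c, 1:] \<longleftrightarrow>
    c = - (1 / 2) \<and> (a = 1 / 2 \<and> b = d \<or> a = - (3 / 2) \<and> b = d + 1 / 2)"
  unfolding wedge_eq_iff[OF f f] wedge_eq_iff[OF g g] wedge_eq_iff[OF f g] wedge_eq_iff[OF g f]
proof (intro iffI)
  assume *: "(c = (a - c) * c - 2 * (b - d) \<and> d = (a - c)\<^sup>2 * d - c * (b - d) - (b - d)\<^sup>2) \<and>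
    c = (c - a) * a - 2 * (d - b) \<and> d = (c - a)\<^sup>2 * b - c * (d - b) - (d - b)\<^sup>2"
  have "c\<^sup>2 - 4 * d \<noteq> 0" using g two by (auto simp: monic_irred_quadratic_pCons_iff)
  moreover have "c\<^sup>2 - 4 * d = (a - c)\<^sup>2 * (c\<^sup>2 - 4 * d)" using * wedge_disc by blast
  ultimately have u2: "(a - c)\<^sup>2 = 1" by (metis mult_cancel_right1)
  have E: "c - ((a - c) * c - 2 * (b - d)) = 0" "c - ((c - a) * a - 2 * (d - b)) = 0"
    unfolding right_minus_eq using * by blast+
  \<comment> \<open>Both wedges equal \<open>g\<close>, so the sum of the two linear equations is
    free of \<open>b - d\<close> and fixes \<open>c\<close>.\<close>
  have "2 * c + (a - c)\<^sup>2 = (c - ((a - c) * c - 2 * (b - d))) + (c - ((c - a) * a - 2 * (d - b)))"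
    by (simp add: algebra_simps power2_eq_square)
  then have "2 * c = -1" unfolding E u2 by (simp add: eq_neg_iff_add_eq_0)
  then have c: "c = - (1 / 2)" using two by (simp add: field_simps)
  have "a = c + 1 \<or> a = c - 1" using u2 unfolding power2_eq_1_iff by (auto simp: algebra_simps)
  then have "a = 1 / 2 \<and> b = d \<or> a = - (3 / 2) \<and> b = d + 1 / 2"
  proof
    assume a: "a = c + 1"
    have "2 * (b - d) = (a - c) * c - c" using * by (simp add: algebra_simps)
    then have "b = d" using two a by simp
    then show ?thesis using two a c by (simp add: field_simps)
  next
    assume a: "a = c - 1"
    then have ac: "a - c = -1" by simp
    have "2 * (b - d) = (a - c) * c - c" using * by (simp add: algebra_simps)
    also have "\<dots> = - (2 * c)" unfolding ac by simp
    also have "\<dots> = 1" using \<open>2 * c = -1\<close> by simp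
    finally have "b = d + 1 / 2" using two by (simp add: field_simps)
    then show ?thesis using two a c by (simp add: field_simps)
  qed
  then show "c = - (1 / 2) \<and> (a = 1 / 2 \<and> b = d \<or> a = - (3 / 2) \<and> b = d + 1 / 2)" using c by simp
next
  assume "c = - (1 / 2) \<and> (a = 1 / 2 \<and> b = d \<or> a = - (3 / 2) \<and> b = d + 1 / 2)"
  then show "(c = (a - c) * c - 2 * (b - d) \<and> d = (a - c)\<^sup>2 * d - c * (b - d) - (b - d)\<^sup>2) \<and>
    c = (c - a) * a - 2 * (d - b) \<and> d = (c - a)\<^sup>2 * b - c * (d - b) - (d - b)\<^sup>2"
  proof (elim conjE disjE)
    assume *: "c = - (1 / 2)" "a = 1 / 2" "b = d"
    have "1 / 2 + 1 / 2 = (1 :: 'a)" using two by (simp add: field_simps)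
    then have ac: "a - c = 1" unfolding * by (simp only: diff_minus_eq_add)
    have "c - a = - (a - c)" by simp
    then have "c - a = -1" unfolding ac .
    moreover have "c = - a" unfolding * ..
    moreover note ac
    ultimately show ?thesis using \<open>b = d\<close> by simp
  next
    \<comment> \<open>With one half as an atom, the check is polynomial arithmetic modulo
      \<open>h + h = 1\<close>.\<close>
    define h where "h = (1 / 2 :: 'a)"
    have h: "h + h = 1" "3 / 2 = h + 1" using two by (simp_all add: h_def field_simps)
    have hh: "h * h + h * h = h" using h(1) by (metis distrib_left mult.right_neutral)
    assume "c = - (1 / 2)" "a = - (3 / 2)" "b = d + 1 / 2"
    then have *: "c = - h" "a = - (h + 1)" "b = d + h" by (simp_all only: h h_def)
    have diff: "a - c = - 1" "c - a = 1" "b - d = h" "d - b = - h" using * by simp_all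
    have "c = - 1 * c - 2 * h" "d = (- 1)\<^sup>2 * d - c * h - h\<^sup>2"
      unfolding * by (simp_all add: power2_eq_square)
    moreover have "c = 1 * a - 2 * (- h)"
    proof -
      have "1 * a - 2 * (- h) = (h + h) - 1 - h" unfolding * by simp
      then show ?thesis unfolding h(1) * by simp
    qed
    moreover have "d = 1\<^sup>2 * b - c * (- h) - (- h)\<^sup>2"
    proof -
      have "1\<^sup>2 * b - c * (- h) - (- h)\<^sup>2 = d + (h - (h * h + h * h))"
        unfolding * by (simp add: power2_eq_square)
      then show ?thesis unfolding hh by simp
    qed
    ultimately show ?thesis unfolding diff by (intro conjI)
  qed
qed

text \<open>The two nonsquares are the discriminants of the two members; that they differ by 1 leads
  to consecutive nonsquares.\<close>

lemma type_I_iff: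
  "type_I (S :: 'a poly set) \<longleftrightarrow> (\<exists>b. S = {[:b, 0, 1:], [:b, -1, 1:]} \<and> nonsquare (- 4 * b) \<and> nonsquare (- 4 * b + 1))"
proof
  assume "type_I S"
  then obtain f g where S: "S = {f, g}" "monic_irred_quadratic f" "monic_irred_quadratic g"
      "wedge f g = g" "wedge g f = f"
    unfolding type_I_def by (subst (asm) stable_2set_labelled_iff) auto
  obtain a b where f: "f = [:b, a, 1:]" using S(2) by (rule monic_irred_quadraticE)
  obtain c d where g: "g = [:d, c, 1:]" using S(3) by (rule monic_irred_quadraticE)
  have "b = d \<and> (a = 0 \<and> c = -1 \<or> a = -1 \<and> c = 0)"
    using wedge_swap_iff S unfolding f g by blast
  then show "\<exists>b. S = {[:b, 0, 1:], [:b, -1, 1:]} \<and> nonsquare (- 4 * b) \<and> nonsquare (- 4 * b + 1)"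
    using S two unfolding f g by (intro exI[of _ b]) (auto simp: monic_irred_quadratic_pCons_iff)
next
  assume "\<exists>b. S = {[:b, 0, 1:], [:b, -1, 1:]} \<and> nonsquare (- 4 * b) \<and> nonsquare (- 4 * b + 1)"
  then obtain b where b: "S = {[:b, 0, 1:], [:b, -1, 1:]}" "nonsquare (- 4 * b)" "nonsquare (- 4 * b + 1)"
    by blast
  then have mi: "monic_irred_quadratic [:b, 0, 1:]" "monic_irred_quadratic [:b, -1, 1:]"
    using two by (auto simp: monic_irred_quadratic_pCons_iff)
  show "type_I S"
    unfolding type_I_def
    by (subst stable_2set_labelled_iff, simp, intro exI[of _ "[:b, 0, 1:]"] exI[of _ "[:b, -1, 1:]"])
      (use b mi wedge_swap_iff[OF mi] in auto)
qed

lemma not_type_II: "\<not> type_II (S :: 'a poly set)"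
proof
  assume "type_II S"
  then obtain f g where S: "S = {f, g}" "monic_irred_quadratic f" "monic_irred_quadratic g"
      "wedge f g = f" "wedge g f = g"
    unfolding type_II_def by (subst (asm) stable_2set_labelled_iff) auto
  obtain a b where f: "f = [:b, a, 1:]" using S(2) by (rule monic_irred_quadraticE)
  obtain c d where g: "g = [:d, c, 1:]" using S(3) by (rule monic_irred_quadraticE)
  show False using not_wedge_fix S unfolding f g by blast
qed

text \<open>One nonsquare condition suffices, since all members in both families have the
  discriminant \<open>1 / 4 - 4 * d\<close>.\<close>

lemma type_III_iff:
  "type_III (S :: 'a poly set) \<longleftrightarrow> (\<exists>d. nonsquare (1 / 4 - 4 * d) \<and>
     (S = {[:d, 1 / 2, 1:], [:d, - (1 / 2), 1:]} \<or> S = {[:d + 1 / 2, - (3 / 2), 1:], [:d, - (1 / 2), 1:]}))"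
proof
  assume "type_III S"
  then obtain f g where S: "S = {f, g}" "monic_irred_quadratic f" "monic_irred_quadratic g"
      "wedge f g = g" "wedge g f = g"
    unfolding type_III_def by (subst (asm) stable_2set_labelled_iff) auto
  obtain a b where f: "f = [:b, a, 1:]" using S(2) by (rule monic_irred_quadraticE)
  obtain c d where g: "g = [:d, c, 1:]" using S(3) by (rule monic_irred_quadraticE)
  have "c = - (1 / 2) \<and> (a = 1 / 2 \<and> b = d \<or> a = - (3 / 2) \<and> b = d + 1 / 2)"
    using wedge_collapse_iff S unfolding f g by blast
  then show "\<exists>d. nonsquare (1 / 4 - 4 * d) \<and>
     (S = {[:d, 1 / 2, 1:], [:d, - (1 / 2), 1:]} \<or> S = {[:d + 1 / 2, - (3 / 2), 1:], [:d, - (1 / 2), 1:]})"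
    using S two unfolding f g
    by (intro exI[of _ d]) (auto simp: monic_irred_quadratic_pCons_iff power_divide)
next
  assume "\<exists>d. nonsquare (1 / 4 - 4 * d) \<and>
     (S = {[:d, 1 / 2, 1:], [:d, - (1 / 2), 1:]} \<or> S = {[:d + 1 / 2, - (3 / 2), 1:], [:d, - (1 / 2), 1:]})"
  then obtain a b d where S: "S = {[:b, a, 1:], [:d, - (1 / 2), 1:]}" "nonsquare (1 / 4 - 4 * d)"
    and ab: "a = 1 / 2 \<and> b = d \<or> a = - (3 / 2) \<and> b = d + 1 / 2"
    by blast
  have disc: "a\<^sup>2 - 4 * b = 1 / 4 - 4 * d"
    using ab
  proof (elim disjE conjE)
    assume *: "a = - (3 / 2)" "b = d + 1 / 2"
    have "a\<^sup>2 = 9 / 4" unfolding * by (simp add: power_divide)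
    also have "\<dots> = 1 / 4 + 2" using four_neq_zero[OF two] by (simp add: field_simps)
    finally have "a\<^sup>2 = 1 / 4 + 2" .
    moreover have "4 * (1 / 2 :: 'a) = 2" using two by (simp add: field_simps)
    ultimately show ?thesis unfolding *(2) distrib_left by (simp only: add_diff_cancel_right)
  next
    assume *: "a = 1 / 2" "b = d"
    show ?thesis unfolding * by (simp add: power_divide)
  qed
  have mi: "monic_irred_quadratic [:b, a, 1:]" "monic_irred_quadratic [:d, - (1 / 2), 1:]"
    unfolding monic_irred_quadratic_pCons_iff[OF two] disc using S by (simp_all add: power_divide)
  have "a \<noteq> - (1 / 2)" using ab halves_neq by metis
  then show "type_III S"
    unfolding type_III_def
    by (subst stable_2set_labelled_iff, simp, intro exI[of _ "[:b, a, 1:]"] exI[of _ "[:d, - (1 / 2), 1:]"])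
      (use S ab mi wedge_collapse_iff[OF mi] in auto)
qed

end

section \<open>Counting the 2-sets of types I and III\<close>

text \<open>The parameter is the discriminant \<open>t = - 4 * b\<close> of the member without
  linear term.\<close>

lemma card_type_I:
  assumes two: "(2 :: 'a :: field) \<noteq> 0"
  shows "card {S :: 'a poly set. type_I S} = card {t :: 'a. nonsquare t \<and> nonsquare (t + 1)}"
proof (rule sym, rule bij_betw_same_card)
  have four: "(4 :: 'a) \<noteq> 0" using two by (rule four_neq_zero)
  show "bij_betw (\<lambda>t. {[:- t / 4, 0, 1:], [:- t / 4, -1, 1:]}) {t :: 'a. nonsquare t \<and> nonsquare (t + 1)}
      {S :: 'a poly set. type_I S}"
    unfolding bij_betw_def
  proof
    show "inj_on (\<lambda>t. {[:- t / 4, 0, 1:], [:- t / 4, -1, 1:]}) {t :: 'a. nonsquare t \<and> nonsquare (t + 1)}"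
      using four by (auto simp: inj_on_def doubleton_eq_iff)
    have "S \<in> (\<lambda>t. {[:- t / 4, 0, 1:], [:- t / 4, -1, 1:]}) ` {t :: 'a. nonsquare t \<and> nonsquare (t + 1)}"
      if S: "type_I S" for S
    proof -
      obtain b where b: "S = {[:b, 0, 1:], [:b, -1, 1:]}" "nonsquare (- 4 * b)" "nonsquare (- 4 * b + 1)"
        using S unfolding type_I_iff[OF two] by blast
      then show ?thesis using four by (intro image_eqI[of _ _ "- 4 * b"]) auto
    qed
    moreover have "type_I {[:- t / 4, 0, 1:], [:- t / 4, -1, 1:]}" if "nonsquare t" "nonsquare (t + 1)" for t :: 'a
      unfolding type_I_iff[OF two] using that four by (intro exI[of _ "- t / 4"]) auto
    ultimately show "(\<lambda>t. {[:- t / 4, 0, 1:], [:- t / 4, -1, 1:]}) ` {t :: 'a. nonsquare t \<and> nonsquare (t + 1)}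
      = {S. type_I S}"
      by blast
  qed
qed

text \<open>The map from \<open>d\<close> to \<open>1 / 4 - 4 * d\<close> matches the parameters
  with the nonsquares. Each parameter yields one 2-set in each of two disjoint families, hence twice
  the number of nonsquares.\<close>

lemma card_type_III:
  assumes two: "(2 :: 'a :: {field, finite}) \<noteq> 0"
  shows "card {S :: 'a poly set. type_III S} = CARD('a) - 1"
proof -
  have four: "(4 :: 'a) \<noteq> 0" using two by (rule four_neq_zero)
  let ?N = "{d :: 'a. nonsquare (1 / 4 - 4 * d)}"
  define F where "F d = {[:d, 1 / 2, 1:], [:d, - (1 / 2), 1:]}" for d :: 'a
  define G where "G d = {[:d + 1 / 2, - (3 / 2), 1:], [:d, - (1 / 2), 1:]}" for d :: 'a
  have inv: "1 / 4 - 4 * ((1 / 4 - x) / 4) = x" for x :: 'a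
    unfolding times_divide_eq_right nonzero_mult_div_cancel_left[OF four] by simp
  have "(\<lambda>d. 1 / 4 - 4 * d) ` ?N = {x. nonsquare x}"
    by (intro equalityI subsetI CollectI; (elim imageE)?)
      (simp, rule image_eqI[where f = "\<lambda>d. 1 / 4 - 4 * d", OF inv[symmetric]], simp only: mem_Collect_eq inv)
  then have "bij_betw (\<lambda>d. 1 / 4 - 4 * d) ?N {x :: 'a. nonsquare x}"
    using four by (intro bij_betw_imageI) (auto simp: inj_on_def)
  then have "2 * card ?N = CARD('a) - 1"
    using card_nonsquare[OF two] by (simp add: bij_betw_same_card)
  moreover have "{S :: 'a poly set. type_III S} = F ` ?N \<union> G ` ?N"
    by (auto simp: type_III_iff[OF two] F_def G_def)
  moreover have "F ` ?N \<inter> G ` ?N = {}"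
    using halves_neq[OF two] by (auto simp: F_def G_def doubleton_eq_iff)
  then have "card (F ` ?N \<union> G ` ?N) = card (F ` ?N) + card (G ` ?N)"
    by (intro card_Un_disjoint) auto
  moreover have "inj F" "inj G"
    using halves_neq[OF two] by (auto simp: inj_on_def F_def G_def doubleton_eq_iff)
  then have "card (F ` ?N) = card ?N" "card (G ` ?N) = card ?N"
    by (auto intro: card_image inj_on_subset)
  ultimately show ?thesis by simp
qed

theorem theorem5p4:
  fixes q :: nat
  assumes "primepow q" and "odd q" and "CARD('a) = q"
  shows "([q = 1] (mod 4) \<longrightarrow>
           real (card {S :: 'a :: {field, finite} poly set. type_I S}) = (real q - 1) / 4) \<and>
         ([q = 3] (mod 4) \<longrightarrow>
           real (card {S :: 'a poly set. type_I S}) = (real q - 3) / 4) \<and>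
         card {S :: 'a poly set. type_II S} = 0 \<and>
         real (card {S :: 'a poly set. type_III S}) = real q - 1"
proof -
  have two: "(2 :: 'a) \<noteq> 0" using assms by (intro two_neq_zero_if_odd_CARD) simp
  define D where "D = card {S :: 'a poly set. type_I S}"
  have q: "q = 4 * D + 1 \<or> q = 4 * D + 3"
    using card_consecutive_nonsquares[OF two] assms(3) by (simp add: D_def card_type_I[OF two])
  \<comment> \<open>The residue of \<open>q\<close> modulo 4 excludes one of the two equations, and
    the other determines \<open>D\<close>.\<close>
  then have "[q = 1] (mod 4) \<longrightarrow> real D = (real q - 1) / 4" "[q = 3] (mod 4) \<longrightarrow> real D = (real q - 3) / 4"
    by (auto simp: cong_def)
  moreover have "real (card {S :: 'a poly set. type_III S}) = real q - 1"
    using q assms(3) by (auto simp: card_type_III[OF two])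
  ultimately show ?thesis by (simp add: D_def not_type_II[OF two])
qed

end
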